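(* Let $H_1$ and $H_2$ be two symmetric $d\times d$ complex Hadamard matrices. If $H_1$ and $H_2$ are $P$-equivalent, then for every graph $G$ the generalized graph states $|\psi_{G,H_1}\rangle$ and $|\psi_{G,H_2}\rangle$ are LU equivalent.
   Context: A complex Hadamard matrix of size $d$ is a $d\times d$ complex matrix $H=(h_{ij})_{i,j=0}^{d-1}$ with $|h_{ij}|=1$ for all $i,j$ and $H^\dagger H=dI_d$; it is symmetric if $H=H^T$. Two Hadamard matrices $H_1,H_2$ are $P$-equivalent if there are a $d\times d$ permutation matrix $P$ and two $d\times d$ diagonal unitary matrices $D_1,D_2$ such that $H_1=PD_1H_2D_2P^T$. A qudit has state space $\mathbb{C}^d$ with computational basis $|0\rangle,\dots,|d-1\rangle$. For symmetric $H$, the generalized controlled-$Z$ gate $C^H$ is the diagonal operator on $\mathbb{C}^d\otimes\mathbb{C}^d$ with $C^H|ij\rangle=h_{ij}|ij\rangle$; $C^H_{ab}$ denotes this gate acting on qudits $a,b$ of an $n$-qudit system. For a (finite, simple) undirected graph $G$ with vertex set $V(G)=\{1,\dots,n\}$ and edge set $E(G)$, the generalized graph state in $(\mathbb{C}^d)^{\otimes n}$ is $$|\psi_{G,H}\rangle=\mathcal{U}_{G,H}|0\rangle^{\otimes n},\qquad \mathcal{U}_{G,H}=\frac{1}{d^{n/2}}\Big(\prod_{ab\in E(G)}C^H_{ab}\Big)H^{\otimes n}.$$ Two $n$-qudit states $|\psi_1\rangle,|\psi_2\rangle$ are LU (local unitary) equivalent if there are single-qudit unitaries $U_1,\dots,U_n$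 with $(U_1\otimes\cdots\otimes U_n)|\psi_1\rangle=|\psi_2\rangle$. *)

theory Defs
  imports
    Complex_Main
    "HOL-Combinatorics.Permutations"
    "Jordan_Normal_Form.Schur_Decomposition"
begin

definition complex_hadamard :: "nat \<Rightarrow> complex mat \<Rightarrow> bool" where
  "complex_hadamard d H \<longleftrightarrow>
     H \<in> carrier_mat d d \<and>
     (\<forall>i<d. \<forall>j<d. cmod (H $$ (i, j)) = 1) \<and>
     mat_adjoint H * H = of_nat d \<cdot>\<^sub>m 1\<^sub>m d"

definition symmetric_mat :: "'a mat \<Rightarrow> bool" where
  "symmetric_mat A \<longleftrightarrow> A\<^sup>T = A"

definition unitary_mat :: "nat \<Rightarrow> complex mat \<Rightarrow> bool" where
  "unitary_mat d U \<longleftrightarrow>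
     U \<in> carrier_mat d d \<and> mat_adjoint U * U = 1\<^sub>m d \<and> U * mat_adjoint U = 1\<^sub>m d"

definition permutation_mat :: "nat \<Rightarrow> complex mat \<Rightarrow> bool" where
  "permutation_mat d P \<longleftrightarrow>
     (\<exists>\<pi>. \<pi> permutes {..<d} \<and> P = mat d d (\<lambda>(i, j). if i = \<pi> j then 1 else 0))"

definition P_equivalent :: "nat \<Rightarrow> complex mat \<Rightarrow> complex mat \<Rightarrow> bool" where
  "P_equivalent d H1 H2 \<longleftrightarrow>
     (\<exists>P D1 D2. permutation_mat d P \<and>
        unitary_mat d D1 \<and> diagonal_mat D1 \<and>
        unitary_mat d D2 \<and> diagonal_mat D2 \<and>
        H1 = P * D1 * H2 * D2 * P\<^sup>T)"

text \<open>
  The space of \<open>n\<close> qudits, labelled \<open>1, \<dots>, n\<close>, is \<open>carrier_vec (d ^ n)\<close>. The basis vector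
  \<open>|x\<^sub>1 \<dots> x\<^sub>n\<rangle>\<close> has the index whose \<open>n\<close>-digit expansion in base \<open>d\<close> is \<open>x\<^sub>1 \<dots> x\<^sub>n\<close>, most significant
  digit first; this is the ordering of the Kronecker product. \<open>qudit d n a k\<close> recovers \<open>x\<^sub>a\<close> from
  the index \<open>k\<close>, for \<open>1 \<le> a \<le> n\<close>.
\<close>

definition qudit :: "nat \<Rightarrow> nat \<Rightarrow> nat \<Rightarrow> nat \<Rightarrow> nat" where
  "qudit d n a k = k div d ^ (n - a) mod d"

definition tensor_vec :: "nat \<Rightarrow> nat \<Rightarrow> (nat \<Rightarrow> complex vec) \<Rightarrow> complex vec" where
  "tensor_vec d n v = vec (d ^ n) (\<lambda>k. \<Prod>a = 1..n. v a $ qudit d n a k)"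

definition tensor_mat :: "nat \<Rightarrow> nat \<Rightarrow> (nat \<Rightarrow> complex mat) \<Rightarrow> complex mat" where
  "tensor_mat d n U =
     mat (d ^ n) (d ^ n) (\<lambda>(k, l). \<Prod>a = 1..n. U a $$ (qudit d n a k, qudit d n a l))"

definition ctrl_gate :: "nat \<Rightarrow> complex mat \<Rightarrow> complex mat" where
  "ctrl_gate d H = mat_diag (d * d) (\<lambda>k. H $$ (k div d, k mod d))"

text \<open>
  The operator on \<open>n\<close> qudits acting as the two-qudit operator \<open>M\<close> on the ordered pair \<open>(a, b)\<close>
  of distinct qudits and as the identity on all others.
\<close>

definition on_qudits :: "nat \<Rightarrow> nat \<Rightarrow> nat \<Rightarrow> nat \<Rightarrow> complex mat \<Rightarrow> complex mat" where
  "on_qudits d n a b M =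
     mat (d ^ n) (d ^ n) (\<lambda>(k, l).
       if \<forall>c \<in> {1..n} - {a, b}. qudit d n c k = qudit d n c l
       then M $$ (qudit d n a k * d + qudit d n b k, qudit d n a l * d + qudit d n b l)
       else 0)"

text \<open>A simple graph on the vertex set \<open>{1..n}\<close> is given by its set of edges.\<close>

definition simple_graph :: "nat \<Rightarrow> nat set set \<Rightarrow> bool" where
  "simple_graph n E \<longleftrightarrow> (\<forall>e \<in> E. e \<subseteq> {1..n} \<and> card e = 2)"

text \<open>
  Each edge is listed exactly once, as \<open>(a, b)\<close> with \<open>a < b\<close>. Neither this orientation nor the
  order of the factors below matters for symmetric matrices; see \<open>ctrl_gate_swap\<close> and
  \<open>ctrl_gate_commute\<close>.
\<close>

definition edge_list :: "nat \<Rightarrow> nat set set \<Rightarrow> (nat \<times> nat) list" where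
  "edge_list n E = [(a, b). a \<leftarrow> [1..<Suc n], b \<leftarrow> [Suc a..<Suc n], {a, b} \<in> E]"

definition graph_operator :: "nat \<Rightarrow> nat \<Rightarrow> nat set set \<Rightarrow> complex mat \<Rightarrow> complex mat" where
  "graph_operator d n E H =
     complex_of_real (1 / real d powr (real n / 2)) \<cdot>\<^sub>m
       (foldr (\<lambda>(a, b) A. on_qudits d n a b (ctrl_gate d H) * A) (edge_list n E) (1\<^sub>m (d ^ n))
        * tensor_mat d n (\<lambda>_. H))"

definition graph_state :: "nat \<Rightarrow> nat \<Rightarrow> nat set set \<Rightarrow> complex mat \<Rightarrow> complex vec" where
  "graph_state d n E H = graph_operator d n E H *\<^sub>v tensor_vec d n (\<lambda>_. unit_vec d 0)"

definition LU_equivalent :: "nat \<Rightarrow> nat \<Rightarrow> complex vec \<Rightarrow> complex vec \<Rightarrow> bool" where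
  "LU_equivalent d n \<psi>1 \<psi>2 \<longleftrightarrow>
     (\<exists>U. (\<forall>a \<in> {1..n}. unitary_mat d (U a)) \<and> tensor_mat d n U *\<^sub>v \<psi>1 = \<psi>2)"

lemma set_edge_list:
  assumes "simple_graph n E"
  shows "set (edge_list n E) = {(a, b). a < b \<and> {a, b} \<in> E}"
proof -
  have ends: "1 \<le> a \<and> b \<le> n" if "{a, b} \<in> E" for a b
    using that assms unfolding simple_graph_def by force
  have "set (edge_list n E) = {(a, b). 1 \<le> a \<and> a < b \<and> b \<le> n \<and> {a, b} \<in> E}"
    unfolding edge_list_def by auto
  also have "\<dots> = {(a, b). a < b \<and> {a, b} \<in> E}"
    using ends by blast
  finally show ?thesis .
qed

lemma qudit_less: "d > 0 \<Longrightarrow> qudit d n a k < d"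
  unfolding qudit_def by simp

lemma qudit_inj:
  assumes "d > 0" "k < d ^ n" "l < d ^ n"
    and "\<And>a. a \<in> {1..n} \<Longrightarrow> qudit d n a k = qudit d n a l"
  shows "k = l"
  using assms(2-)
proof (induction n arbitrary: k l)
  case (Suc n)
  have "qudit d n a (k div d) = qudit d n a (l div d)" if "a \<in> {1..n}" for a
    using Suc.prems(3)[of a] that
    by (simp add: qudit_def Suc_diff_le div_mult2_eq)
  moreover have "k div d < d ^ n" "l div d < d ^ n"
    using Suc.prems(1,2) by (intro less_mult_imp_div_less; simp only: power_Suc2)+
  ultimately have "k div d = l div d"
    using Suc.IH by blast
  moreover have "k mod d = l mod d"
    using Suc.prems(3)[of "Suc n"] by (simp add: qudit_def)
  ultimately show ?case
    by (metis div_mult_mod_eq)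
qed simp

lemma on_qudits_ctrl_gate:
  assumes "d > 0" "a \<in> {1..n}" "b \<in> {1..n}"
  shows "on_qudits d n a b (ctrl_gate d H) =
    mat_diag (d ^ n) (\<lambda>k. H $$ (qudit d n a k, qudit d n b k))"
proof (rule eq_matI, goal_cases)
  case (1 k l)
  then have kl: "k < d ^ n" "l < d ^ n" by (auto simp: mat_diag_def)
  have lt: "x * d + y < d * d" if "x < d" "y < d" for x y :: nat
  proof -
    have "x * d + y < Suc x * d" using that by simp
    also have "\<dots> \<le> d * d" using that by (intro mult_right_mono) auto
    finally show ?thesis .
  qed
  have quot: "(x * d + y) div d = x" if "y < d" for x y :: nat
    using that by simp
  have pair: "x = x' \<and> y = y'" if "x * d + y = x' * d + y'" "y < d" "y' < d" for x y x' y' :: nat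
    using that by (metis add.commute assms(1) div_less div_mult_self1 mod_less mod_mult_self1
        add_0 less_numeral_extra(3))
  show ?case
  proof (cases "k = l")
    case True
    then show ?thesis using kl lt qudit_less[OF assms(1)]
      by (simp add: quot on_qudits_def ctrl_gate_def mat_diag_def)
  next
    case False
    then obtain c where c: "c \<in> {1..n}" "qudit d n c k \<noteq> qudit d n c l"
      using qudit_inj[OF assms(1) kl] by blast
    then have "qudit d n a k * d + qudit d n b k \<noteq> qudit d n a l * d + qudit d n b l"
      if "\<forall>c \<in> {1..n} - {a, b}. qudit d n c k = qudit d n c l"
      using that pair qudit_less[OF assms(1)] by (metis Diff_iff insertE singletonD)
    then show ?thesis using False kl lt qudit_less[OF assms(1)]
      by (auto simp: on_qudits_def ctrl_gate_def mat_diag_def)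
  qed
qed (auto simp: on_qudits_def mat_diag_def)

lemma ctrl_gate_swap:
  assumes "d > 0" "a \<in> {1..n}" "b \<in> {1..n}" "H \<in> carrier_mat d d" "symmetric_mat H"
  shows "on_qudits d n a b (ctrl_gate d H) = on_qudits d n b a (ctrl_gate d H)"
proof -
  have "H $$ (i, j) = H $$ (j, i)" if "i < d" "j < d" for i j
    using assms(4,5) that unfolding symmetric_mat_def by (metis carrier_matD index_transpose_mat(1))
  then show ?thesis
    using qudit_less[OF assms(1)]
    by (simp add: on_qudits_ctrl_gate[OF assms(1-3)] on_qudits_ctrl_gate[OF assms(1,3,2)])
qed

lemma ctrl_gate_commute:
  assumes "d > 0" "a \<in> {1..n}" "b \<in> {1..n}" "a' \<in> {1..n}" "b' \<in> {1..n}"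
  shows "on_qudits d n a b (ctrl_gate d H) * on_qudits d n a' b' (ctrl_gate d H) =
         on_qudits d n a' b' (ctrl_gate d H) * on_qudits d n a b (ctrl_gate d H)"
  by (simp add: on_qudits_ctrl_gate[OF assms(1-3)] on_qudits_ctrl_gate[OF assms(1,4,5)]
      mult.commute)

end

theory Submission
  imports Defs
begin

text \<open>
  If \<open>H1 = P D1 H2 D2 P\<^sup>T\<close>, where \<open>P\<close> permutes the basis by \<open>\<pi>\<close>, then
  \<open>H1 (\<pi> i) (\<pi> j) = \<alpha> i * H2 i j * \<beta> j\<close> with unimodular \<open>\<alpha>\<close> and \<open>\<beta>\<close>. The amplitude of a graph state at
  \<open>x\<close> is, up to the normalisation, the product of \<open>H x\<^sub>a x\<^sub>b\<close> over the edges times the product of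
  \<open>H x\<^sub>a 0\<close> over the vertices. Hence the amplitude of the first state at \<open>\<pi> x\<close> and of the second at
  \<open>x\<close> differ by a product of phases, each of which depends on a single \<open>x\<^sub>a\<close>. So a permutation of
  the basis followed by a diagonal unitary on each qudit maps one state to the other.
\<close>

section \<open>Digits of basis indices\<close>

lemma qudit_surj:
  assumes "d > 0" and "\<And>a. a \<in> {1..n} \<Longrightarrow> f a < d"
  obtains k where "k < d ^ n" "\<And>a. a \<in> {1..n} \<Longrightarrow> qudit d n a k = f a"
proof -
  \<comment> \<open>Surjectivity follows by counting: the digit map \<open>?q\<close> is injective
    and goes between two sets of \<open>d ^ n\<close> elements. The restriction to
    \<open>{1..n}\<close> makes digit tuples elements of \<open>PiE\<close>.\<close>
  let ?q = "\<lambda>k. restrict (\<lambda>a. qudit d n a k) {1..n}"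
  let ?S = "PiE {1..n} (\<lambda>_. {..<d})"
  have "inj_on ?q {..<d ^ n}"
  proof (rule inj_onI)
    fix k l assume "k \<in> {..<d ^ n}" "l \<in> {..<d ^ n}" "?q k = ?q l"
    then show "k = l"
      using qudit_inj[OF assms(1), of k n l] by (metis lessThan_iff restrict_apply')
  qed
  moreover have "?q ` {..<d ^ n} \<subseteq> ?S"
    using qudit_less[OF assms(1)] by auto
  moreover have "card ?S = d ^ n" by (simp add: card_PiE)
  ultimately have "?q ` {..<d ^ n} = ?S"
    by (intro card_subset_eq finite_PiE) (auto simp: card_image)
  moreover have "restrict f {1..n} \<in> ?S" using assms(2) by auto
  ultimately have "restrict f {1..n} \<in> ?q ` {..<d ^ n}" by blast
  then obtain k where k: "k < d ^ n" "restrict f {1..n} = ?q k" by blast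
  have "qudit d n a k = f a" if "a \<in> {1..n}" for a
    using k(2) that by (metis restrict_apply')
  with k(1) show thesis by (rule that)
qed

text \<open>Entries of tensor products of sparse factors are products of conditionals. This turns
  them into one condition on all digits, which \<open>qudit_inj\<close> then reads as an equality of
  indices.\<close>

lemma prod_indicator:
  fixes f :: "'a \<Rightarrow> 'b :: comm_semiring_1"
  assumes "finite A"
  shows "(\<Prod>a\<in>A. if P a then f a else 0) = (if \<forall>a\<in>A. P a then \<Prod>a\<in>A. f a else 0)"
  using assms by induction auto

lemma tensor_vec_unit_vec:
  assumes "d > 0"
  shows "tensor_vec d n (\<lambda>_. unit_vec d 0) = unit_vec (d ^ n) 0"
proof (rule eq_vecI)
  fix k assume "k < dim_vec (unit_vec (d ^ n) 0 :: complex vec)"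
  then have k: "k < d ^ n" by simp
  have "(\<forall>a\<in>{1..n}. qudit d n a k = 0) \<longleftrightarrow> k = 0"
    using qudit_inj[OF assms k, of 0] assms by (auto simp: qudit_def)
  then show "tensor_vec d n (\<lambda>_. unit_vec d 0) $ k = (unit_vec (d ^ n) 0 :: complex vec) $ k"
    using k qudit_less[OF assms] by (simp add: tensor_vec_def unit_vec_def prod_indicator)
qed (simp add: tensor_vec_def)

section \<open>Amplitudes of a graph state\<close>

lemma edge_list_vertices:
  "(a, b) \<in> set (edge_list n E) \<Longrightarrow> a \<in> {1..n} \<and> b \<in> {1..n}"
  by (auto simp: edge_list_def)

text \<open>Every gate is diagonal, so the diagonals multiply pointwise. The list is arbitrary
  because the tail of an edge list need not be the edge list of a graph.\<close>

lemma foldr_on_qudits_ctrl_gate: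
  assumes "d > 0" and "\<And>a b. (a, b) \<in> set L \<Longrightarrow> a \<in> {1..n} \<and> b \<in> {1..n}"
  shows "foldr (\<lambda>(a, b) A. on_qudits d n a b (ctrl_gate d H) * A) L (1\<^sub>m (d ^ n)) =
    mat_diag (d ^ n) (\<lambda>k. \<Prod>(a, b)\<leftarrow>L. H $$ (qudit d n a k, qudit d n b k))"
  using assms(2)
proof (induction L)
  case Nil
  then show ?case by simp
next
  case (Cons e L)
  obtain a b where e: "e = (a, b)" by (cases e)
  have "a \<in> {1..n}" "b \<in> {1..n}" using Cons.prems[of a b] by (auto simp: e)
  note gate = on_qudits_ctrl_gate[OF assms(1) this]
  have "foldr (\<lambda>(a, b) A. on_qudits d n a b (ctrl_gate d H) * A) L (1\<^sub>m (d ^ n)) =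
      mat_diag (d ^ n) (\<lambda>k. \<Prod>(a, b)\<leftarrow>L. H $$ (qudit d n a k, qudit d n b k))"
    by (intro Cons.IH Cons.prems) simp
  then show ?case by (simp add: e gate)
qed

text \<open>The initial state is the basis vector of index 0, so only column 0 of the tensor power
  of \<open>H\<close> survives. All digits of 0 are 0, which gives the factors
  \<open>H $$ (qudit d n a k, 0)\<close>; the gates then only rescale each entry.\<close>

lemma graph_state_eq:
  assumes "d > 0"
  shows "graph_state d n E H = vec (d ^ n) (\<lambda>k. complex_of_real (1 / real d powr (real n / 2)) *
    ((\<Prod>(a, b)\<leftarrow>edge_list n E. H $$ (qudit d n a k, qudit d n b k)) *
     (\<Prod>a = 1..n. H $$ (qudit d n a k, 0))))"
proof -
  let ?c = "complex_of_real (1 / real d powr (real n / 2))"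
  let ?e = "\<lambda>k. \<Prod>(a, b)\<leftarrow>edge_list n E. H $$ (qudit d n a k, qudit d n b k)"
  let ?T = "tensor_mat d n (\<lambda>_. H)"
  have T: "?T \<in> carrier_mat (d ^ n) (d ^ n)" by (simp add: tensor_mat_def)
  have "foldr (\<lambda>(a, b) A. on_qudits d n a b (ctrl_gate d H) * A) (edge_list n E) (1\<^sub>m (d ^ n)) =
      mat_diag (d ^ n) ?e"
    by (intro foldr_on_qudits_ctrl_gate assms edge_list_vertices)
  then have "graph_state d n E H =
      (?c \<cdot>\<^sub>m mat (d ^ n) (d ^ n) (\<lambda>(i, j). ?e i * ?T $$ (i, j))) *\<^sub>v unit_vec (d ^ n) 0"
    by (simp only: graph_state_def graph_operator_def tensor_vec_unit_vec[OF assms]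
        mat_diag_mult_left[OF T])
  also have "\<dots> = vec (d ^ n) (\<lambda>k. ?c * (?e k * ?T $$ (k, 0)))"
    using assms by (intro eq_vecI) simp_all
  also have "\<dots> = vec (d ^ n) (\<lambda>k. ?c * (?e k * (\<Prod>a = 1..n. H $$ (qudit d n a k, 0))))"
    using assms by (intro eq_vecI) (simp_all add: tensor_mat_def qudit_def)
  finally show ?thesis .
qed

section \<open>Local unitaries that permute and rephase the basis\<close>

definition monomial_mat :: "nat \<Rightarrow> (nat \<Rightarrow> nat) \<Rightarrow> (nat \<Rightarrow> complex) \<Rightarrow> complex mat" where
  "monomial_mat d \<pi> f = mat d d (\<lambda>(i, j). if j = \<pi> i then f i else 0)"

text \<open>Distinct rows have disjoint supports, as \<pi> is injective, and each row is a unit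
  vector. This gives one of the two identities; the other follows because the matrix is
  square.\<close>

lemma unitary_monomial_mat:
  assumes \<pi>: "\<pi> permutes {..<d}" and f: "\<And>i. i < d \<Longrightarrow> cmod (f i) = 1"
  shows "unitary_mat d (monomial_mat d \<pi> f)"
proof -
  let ?U = "monomial_mat d \<pi> f"
  have U: "?U \<in> carrier_mat d d" by (simp add: monomial_mat_def)
  then have A: "mat_adjoint ?U \<in> carrier_mat d d" by (auto simp: mat_adjoint_def)
  have "?U * mat_adjoint ?U = 1\<^sub>m d"
  proof (rule eq_matI)
    fix i j assume "i < dim_row (1\<^sub>m d :: complex mat)" "j < dim_col (1\<^sub>m d :: complex mat)"
    then have ij: "i < d" "j < d" by auto
    have \<pi>i: "\<pi> i < d" using permutes_in_image[OF \<pi>] ij by simp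
    have \<pi>_eq: "\<pi> i = \<pi> j \<longleftrightarrow> i = j" using permutes_inj[OF \<pi>] by (auto dest: injD)
    have "(?U * mat_adjoint ?U) $$ (i, j) =
        (\<Sum>k<d. (if k = \<pi> i then f i else 0) * cnj (if k = \<pi> j then f j else 0))"
      using ij by (simp add: mat_adjoint_def monomial_mat_def scalar_prod_def mat_of_rows_index lessThan_atLeast0)
    also have "\<dots> = (\<Sum>k<d. if k = \<pi> i then (if i = j then f i * cnj (f j) else 0) else 0)"
      using \<pi>_eq by (intro sum.cong) auto
    also have "\<dots> = (1\<^sub>m d :: complex mat) $$ (i, j)"
      using ij \<pi>i f by (simp add: complex_norm_square[symmetric])
    finally show "(?U * mat_adjoint ?U) $$ (i, j) = (1\<^sub>m d :: complex mat) $$ (i, j)" .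
  qed (use U A in auto)
  with mat_mult_left_right_inverse[OF U A] U show ?thesis by (simp add: unitary_mat_def)
qed

text \<open>Row \<open>k\<close> of the tensor product can be nonzero only in column
  \<open>l\<close>. The product thus reads \<open>v\<close> at the permuted digits and writes at the
  original ones, so the inverse of \<pi> never appears.\<close>

lemma tensor_monomial_mat_mult_vec:
  assumes "d > 0" and v: "v \<in> carrier_vec (d ^ n)" and "k < d ^ n" "l < d ^ n"
    and l: "\<And>a. a \<in> {1..n} \<Longrightarrow> qudit d n a l = \<pi> (qudit d n a k)"
  shows "(tensor_mat d n (\<lambda>a. monomial_mat d \<pi> (f a)) *\<^sub>v v) $ k =
    (\<Prod>a = 1..n. f a (qudit d n a k)) * v $ l"
proof -
  have "(\<Prod>a = 1..n. monomial_mat d \<pi> (f a) $$ (qudit d n a k, qudit d n a m)) =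
      (if m = l then \<Prod>a = 1..n. f a (qudit d n a k) else 0)" if "m < d ^ n" for m
  proof -
    have "(\<forall>a\<in>{1..n}. qudit d n a m = \<pi> (qudit d n a k)) \<longleftrightarrow> m = l"
      using qudit_inj[OF assms(1) that \<open>l < d ^ n\<close>] l by auto
    then show ?thesis
      by (simp add: monomial_mat_def qudit_less[OF assms(1)] prod_indicator)
  qed
  note entry = this
  have "(tensor_mat d n (\<lambda>a. monomial_mat d \<pi> (f a)) *\<^sub>v v) $ k =
      (\<Sum>m<d ^ n. (\<Prod>a = 1..n. monomial_mat d \<pi> (f a) $$ (qudit d n a k, qudit d n a m)) * v $ m)"
    using v \<open>k < d ^ n\<close> by (simp add: tensor_mat_def scalar_prod_def lessThan_atLeast0)
  also have "\<dots> = (\<Sum>m<d ^ n. if m = l then (\<Prod>a = 1..n. f a (qudit d n a k)) * v $ m else 0)"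
    by (intro sum.cong refl) (simp add: entry del: One_nat_def)
  finally show ?thesis using \<open>l < d ^ n\<close> by simp
qed

section \<open>P-equivalence in terms of matrix entries\<close>

lemma diagonal_mat_eq_mat_diag:
  assumes "D \<in> carrier_mat d d" "diagonal_mat D"
  shows "D = mat_diag d (\<lambda>i. D $$ (i, i))"
  using assms by (intro eq_matI) (auto simp: diagonal_mat_def mat_diag_def)

lemma unitary_diagonal_mat_cmod:
  assumes "unitary_mat d D" "diagonal_mat D" "i < d"
  shows "cmod (D $$ (i, i)) = 1"
proof -
  have D: "D \<in> carrier_mat d d" and eq: "D * mat_adjoint D = 1\<^sub>m d"
    using assms(1) by (auto simp: unitary_mat_def)
  have "1 = (D * mat_adjoint D) $$ (i, i)" using eq assms(3) by simp
  also have "\<dots> = (\<Sum>k<d. D $$ (i, k) * cnj (D $$ (i, k)))"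
    using D assms(3)
    by (simp add: mat_adjoint_def scalar_prod_def mat_of_rows_index lessThan_atLeast0)
  also have "\<dots> = (\<Sum>k<d. if k = i then D $$ (i, i) * cnj (D $$ (i, i)) else 0)"
    using D assms(2,3) by (intro sum.cong) (auto simp: diagonal_mat_def)
  also have "\<dots> = complex_of_real ((cmod (D $$ (i, i)))\<^sup>2)"
    using assms(3) by (simp add: complex_norm_square del: of_real_power)
  finally show ?thesis
    by (metis norm_ge_zero of_real_eq_1_iff power2_eq_1_iff abs_of_nonneg abs_minus_cancel abs_one)
qed

text \<open>The phases \<alpha> and \<beta> are the diagonals of \<open>D1\<close> and
  \<open>D2\<close>. Evaluation at permuted positions undoes the conjugation by
  \<open>P\<close>.\<close>

lemma P_equivalentE:
  assumes "P_equivalent d H1 H2" and H2: "H2 \<in> carrier_mat d d"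
  obtains \<pi> \<alpha> \<beta> where "\<pi> permutes {..<d}"
    and "\<And>i. i < d \<Longrightarrow> cmod (\<alpha> i) = 1" and "\<And>i. i < d \<Longrightarrow> cmod (\<beta> i) = 1"
    and "\<And>i j. i < d \<Longrightarrow> j < d \<Longrightarrow> H1 $$ (\<pi> i, \<pi> j) = \<alpha> i * H2 $$ (i, j) * \<beta> j"
proof -
  obtain P D1 D2 where P: "permutation_mat d P"
    and D1: "unitary_mat d D1" "diagonal_mat D1" and D2: "unitary_mat d D2" "diagonal_mat D2"
    and H1: "H1 = P * D1 * H2 * D2 * P\<^sup>T"
    using assms(1) unfolding P_equivalent_def by blast
  obtain \<pi> where \<pi>: "\<pi> permutes {..<d}"
    and P_eq: "P = mat d d (\<lambda>(i, j). if i = \<pi> j then 1 else 0)"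
    using P unfolding permutation_mat_def by blast
  have carr: "P \<in> carrier_mat d d" "D1 \<in> carrier_mat d d" "D2 \<in> carrier_mat d d"
    using D1 D2 by (auto simp: P_eq unitary_mat_def)
  have \<pi>_less: "\<pi> i < d" if "i < d" for i using permutes_in_image[OF \<pi>] that by simp
  have \<pi>_eq: "\<pi> i = \<pi> j \<longleftrightarrow> i = j" for i j using permutes_inj[OF \<pi>] by (auto dest: injD)
  have delta: "(if c then 1 else 0) * z = (if c then z else 0)"
    "z * (if c then 1 else 0) = (if c then z else 0)" for c and z :: complex by auto
  \<comment> \<open>Row \<open>\<pi> i\<close> of \<open>P\<close> has its only 1 in column
    \<open>i\<close>, so left multiplication by \<open>P\<close> moves row \<open>i\<close> to row
    \<open>\<pi> i\<close>. The transpose on the right does the same to columns.\<close>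
  have P_mult: "(P * A) $$ (\<pi> i, j) = A $$ (i, j)"
    if "A \<in> carrier_mat d d" "i < d" "j < d" for A i j
    using that \<pi>_less
    by (simp add: P_eq scalar_prod_def \<pi>_eq delta)
  have mult_P: "(A * P\<^sup>T) $$ (i, \<pi> j) = A $$ (i, j)"
    if "A \<in> carrier_mat d d" "i < d" "j < d" for A i j
    using that \<pi>_less
    by (simp add: P_eq scalar_prod_def \<pi>_eq delta)
  have mid: "(D1 * (H2 * D2)) $$ (i, j) = D1 $$ (i, i) * H2 $$ (i, j) * D2 $$ (j, j)"
    if "i < d" "j < d" for i j
  proof -
    have "D1 * (H2 * D2) =
        mat_diag d (\<lambda>i. D1 $$ (i, i)) * (H2 * mat_diag d (\<lambda>j. D2 $$ (j, j)))"
      using diagonal_mat_eq_mat_diag[OF carr(2) D1(2)] diagonal_mat_eq_mat_diag[OF carr(3) D2(2)]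
      by simp
    then show ?thesis
      using that H2 by (simp add: mat_diag_mult_left[of _ d d] mat_diag_mult_right[OF H2])
  qed
  have "H1 $$ (\<pi> i, \<pi> j) = D1 $$ (i, i) * H2 $$ (i, j) * D2 $$ (j, j)"
    if ij: "i < d" "j < d" for i j
  proof -
    have M: "D1 * (H2 * D2) \<in> carrier_mat d d" using carr H2 by auto
    have "H1 = P * (D1 * (H2 * D2)) * P\<^sup>T"
      unfolding H1 using carr H2 by (simp add: assoc_mult_mat[of _ d d _ d _ d])
    then have "H1 $$ (\<pi> i, \<pi> j) = (P * (D1 * (H2 * D2))) $$ (\<pi> i, j)"
      using mult_P[of "P * (D1 * (H2 * D2))" "\<pi> i" j] carr(1) M \<pi>_less ij by simp
    then show ?thesis using P_mult[OF M ij] mid[OF ij] by simp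
  qed
  with \<pi> unitary_diagonal_mat_cmod[OF D1] unitary_diagonal_mat_cmod[OF D2] show thesis
    by (intro that[of \<pi> "\<lambda>i. D1 $$ (i, i)" "\<lambda>j. D2 $$ (j, j)"])
qed

section \<open>Distributing the edge phases over the vertices\<close>

lemma prod_prod_list_swap:
  fixes F :: "'a \<Rightarrow> 'b \<Rightarrow> 'c :: comm_monoid_mult"
  shows "(\<Prod>v\<in>A. \<Prod>e\<leftarrow>L. F v e) = (\<Prod>e\<leftarrow>L. \<Prod>v\<in>A. F v e)"
  by (induction L) (simp_all add: prod.distrib)

lemma prod_list_map_mult:
  fixes f g :: "'a \<Rightarrow> 'c :: comm_monoid_mult"
  shows "(\<Prod>e\<leftarrow>L. f e * g e) = (\<Prod>e\<leftarrow>L. f e) * (\<Prod>e\<leftarrow>L. g e)"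
  by (induction L) (simp_all add: ac_simps)

lemma norm_prod_list_eq_1:
  fixes f :: "'a \<Rightarrow> complex"
  assumes "\<And>e. cmod (f e) = 1"
  shows "cmod (\<Prod>e\<leftarrow>L. f e) = 1"
  using assms by (induction L) (simp_all add: norm_mult)

theorem theorem14:
  fixes d :: nat and H1 H2 :: "complex mat"
  assumes "d > 0"
    and "complex_hadamard d H1" and "symmetric_mat H1"
    and "complex_hadamard d H2" and "symmetric_mat H2"
    and "P_equivalent d H1 H2"
  shows "\<forall>n E. simple_graph n E \<longrightarrow>
           LU_equivalent d n (graph_state d n E H1) (graph_state d n E H2)"
proof (intro allI impI)
  fix n E
  have H2: "H2 \<in> carrier_mat d d"
    and H1_cmod: "\<And>i j. i < d \<Longrightarrow> j < d \<Longrightarrow> cmod (H1 $$ (i, j)) = 1"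
    and H2_cmod: "\<And>i j. i < d \<Longrightarrow> j < d \<Longrightarrow> cmod (H2 $$ (i, j)) = 1"
    using assms(2,4) by (auto simp: complex_hadamard_def)
  obtain \<pi> \<alpha> \<beta> where \<pi>: "\<pi> permutes {..<d}"
    and \<alpha>: "\<And>i. i < d \<Longrightarrow> cmod (\<alpha> i) = 1" and \<beta>: "\<And>i. i < d \<Longrightarrow> cmod (\<beta> i) = 1"
    and H1: "\<And>i j. i < d \<Longrightarrow> j < d \<Longrightarrow> H1 $$ (\<pi> i, \<pi> j) = \<alpha> i * H2 $$ (i, j) * \<beta> j"
    by (rule P_equivalentE[OF assms(6) H2]) blast
  have \<pi>_less: "\<pi> i < d" if "i < d" for i using permutes_in_image[OF \<pi>] that by simp
  define L where "L = edge_list n E"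
  \<comment> \<open>An edge \<open>(a, b)\<close> brings the surplus phase
    \<open>\<alpha> (x a) * \<beta> (x b)\<close>. Qudit \<open>v\<close> cancels its own share: an
    inverse \<alpha> for each edge where it is the first endpoint, an inverse \<beta> where it is
    the second.\<close>
  define g where "g v x = (\<Prod>(a, b)\<leftarrow>L.
      (if a = v then inverse (\<alpha> x) else 1) * (if b = v then inverse (\<beta> x) else 1))" for v x
  \<comment> \<open>The vertex factors sit in column 0 of both matrices, whereas the relation
    between \<open>H1\<close> and \<open>H2\<close> would pair column 0 with column
    \<open>\<pi> 0\<close>. The correction is therefore the quotient itself, of modulus 1 because
    all entries are unimodular.\<close>
  define f where "f v x = g v x * (H2 $$ (x, 0) / H1 $$ (\<pi> x, 0))" for v x
  define U where "U = (\<lambda>v. monomial_mat d \<pi> (f v))"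
  have "cmod (g v x) = 1" if "x < d" for v x
    unfolding g_def using \<alpha>[OF that] \<beta>[OF that]
    by (intro norm_prod_list_eq_1) (auto simp: norm_mult norm_inverse)
  then have "cmod (f v x) = 1" if "x < d" for v x
    using H1_cmod[OF \<pi>_less[OF that] assms(1)] H2_cmod[OF that assms(1)] that
    by (simp add: f_def norm_mult norm_divide)
  then have "unitary_mat d (U v)" for v
    unfolding U_def by (intro unitary_monomial_mat[OF \<pi>])
  moreover have "tensor_mat d n U *\<^sub>v graph_state d n E H1 = graph_state d n E H2"
  proof (rule eq_vecI)
    have dim: "graph_state d n E H \<in> carrier_vec (d ^ n)" for H
      by (simp add: graph_state_eq[OF assms(1)])
    show "dim_vec (tensor_mat d n U *\<^sub>v graph_state d n E H1) = dim_vec (graph_state d n E H2)"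
      by (simp add: tensor_mat_def carrier_vecD[OF dim])
    fix k assume "k < dim_vec (graph_state d n E H2)"
    then have k: "k < d ^ n" by (simp add: carrier_vecD[OF dim])
    define x where "x a = qudit d n a k" for a
    have x: "x a < d" for a by (simp add: x_def qudit_less[OF assms(1)])
    obtain l where l: "l < d ^ n" "\<And>a. a \<in> {1..n} \<Longrightarrow> qudit d n a l = \<pi> (x a)"
      using qudit_surj[OF assms(1), of n "\<lambda>a. \<pi> (x a)"] \<pi>_less x by blast
    note edge = edge_list_vertices[of _ _ n E, folded L_def]
    have nz: "\<alpha> i \<noteq> 0" "\<beta> i \<noteq> 0" "H1 $$ (\<pi> i, 0) \<noteq> 0" if "i < d" for i
      using \<alpha>[OF that] \<beta>[OF that] H1_cmod[OF \<pi>_less[OF that] assms(1)] by auto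
    \<comment> \<open>After the two products are exchanged, each edge keeps one factor for
      \<open>v = a\<close> and one for \<open>v = b\<close>, since both endpoints lie in
      \<open>{1..n}\<close>.\<close>
    have "(\<Prod>v = 1..n. g v (x v)) = (\<Prod>(a, b)\<leftarrow>L. inverse (\<alpha> (x a)) * inverse (\<beta> (x b)))"
      unfolding g_def prod_prod_list_swap
      using edge by (intro arg_cong[where f = prod_list] map_cong) (auto simp: prod.distrib)
    then have edges: "(\<Prod>v = 1..n. g v (x v)) *
        (\<Prod>(a, b)\<leftarrow>L. H1 $$ (qudit d n a l, qudit d n b l)) = (\<Prod>(a, b)\<leftarrow>L. H2 $$ (x a, x b))"
      using edge l(2) nz x
      by (auto simp: prod_list_map_mult[symmetric] H1 field_simps
          intro!: arg_cong[where f = prod_list])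
    have vertices: "(\<Prod>v = 1..n. H2 $$ (x v, 0) / H1 $$ (\<pi> (x v), 0)) *
        (\<Prod>a = 1..n. H1 $$ (qudit d n a l, 0)) = (\<Prod>a = 1..n. H2 $$ (x a, 0))"
      using l(2) nz x by (simp flip: prod.distrib)
    define c where "c = complex_of_real (1 / real d powr (real n / 2))"
    have "(tensor_mat d n U *\<^sub>v graph_state d n E H1) $ k =
        (\<Prod>v = 1..n. f v (x v)) * graph_state d n E H1 $ l"
      unfolding U_def x_def
      using l by (intro tensor_monomial_mat_mult_vec[OF assms(1) dim k]) (simp_all add: x_def)
    also have "\<dots> =
        (\<Prod>v = 1..n. g v (x v)) * (\<Prod>v = 1..n. H2 $$ (x v, 0) / H1 $$ (\<pi> (x v), 0)) *
        (c * ((\<Prod>(a, b)\<leftarrow>L. H1 $$ (qudit d n a l, qudit d n b l)) *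
          (\<Prod>a = 1..n. H1 $$ (qudit d n a l, 0))))"
      by (simp only: f_def prod.distrib graph_state_eq[OF assms(1)] index_vec[OF l(1)] c_def L_def)
    also have "\<dots> =
        c * (((\<Prod>v = 1..n. g v (x v)) *
          (\<Prod>(a, b)\<leftarrow>L. H1 $$ (qudit d n a l, qudit d n b l))) *
         ((\<Prod>v = 1..n. H2 $$ (x v, 0) / H1 $$ (\<pi> (x v), 0)) *
          (\<Prod>a = 1..n. H1 $$ (qudit d n a l, 0))))"
      by (simp only: ac_simps)
    also have "\<dots> = graph_state d n E H2 $ k"
      unfolding edges vertices
      by (simp only: graph_state_eq[OF assms(1)] index_vec[OF k] c_def L_def x_def)
    finally show "(tensor_mat d n U *\<^sub>v graph_state d n E H1) $ k = graph_state d n E H2 $ k" .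
  qed
  ultimately show "LU_equivalent d n (graph_state d n E H1) (graph_state d n E H2)"
    unfolding LU_equivalent_def by blast
qed

end
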